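(* Let $A$ be an irreducible $n\times n$ max-plus matrix. Then the transient of the sequence of max-plus powers $A^{\otimes k}$ ($k\geq 0$) is at most \[ 2n^2+\frac{2n^2\lVert A\rVert}{\lambda(A)-\lambda_2(A)}. \]
   Context: Max-plus algebra: $\mathbb{R}_{\max}=\mathbb{R}\cup\{-\infty\}$ with $a\oplus b=\max\{a,b\}$ and $a\otimes b=a+b$. A max-plus matrix has entries in $\mathbb{R}_{\max}$; the product is $(A\otimes B)_{i,j}=\max_h (A_{i,h}+B_{h,j})$ and $A^{\otimes k}$ is the $k$-th max-plus power ($A^{\otimes 0}$ has $0$ on the diagonal and $-\infty$ elsewhere). The digraph $G(A)$ has node set $\{1,\dots,n\}$ and an edge $(i,j)$ iff $A_{i,j}\neq-\infty$, with weight $A_{i,j}$; $A$ is irreducible if $G(A)$ is strongly connected. The weight $A(\Gamma)$ of a cycle $\Gamma$ is the sum of its edge weights and $\ell(\Gamma)$ its length. $\lambda(A)$ is the maximum of $A(\Gamma)/\ell(\Gamma)$ over cycles $\Gamma$ of $G(A)$; cycles attaining it are critical. $\lambda_2(A)$ is the second largest cycle mean, i.e. the maximum of $A(\Gamma)/\ell(\Gamma)$ over cycles with $A(\Gamma)/\ell(\Gamma)<\lambda(A)$ (if no such cycle exists, $\lambda_2(A)=-\infty$ and the quotient in the bound is read as $0$). $\lVert A\rVert$ is the difference between the greatest and the smallest finite entries of $A$. A matrix sequence $a(k)$ is eventually periodic with period $p\geq1$ and ratio $\varrho\in\mathbb{R}$ if there is $K$ with $a(k+p)=a(k)+p\varrho$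 entrywise for all $k\geq K$; the transient is the smallest such $K$ (it does not depend on the chosen period). For irreducible $A$ the sequence $A^{\otimes k}$ is eventually periodic with ratio $\lambda(A)$. *)

theory Defs
  imports
    "HOL-Analysis.Finite_Cartesian_Product"
    "HOL-Library.Extended_Real"
    "Graph_Theory.Digraph_Component"
    "Graph_Theory.Arc_Walk"
begin

text \<open>
  The max-plus semiring is represented by the extended reals different from
  \<^term>\<open>\<infinity> :: ereal\<close>; away from \<^term>\<open>\<infinity> :: ereal\<close>, addition of extended reals is
  absorbing at \<^term>\<open>- \<infinity> :: ereal\<close>.
\<close>

definition maxplus_matrix :: "ereal ^ 'n ^ 'n \<Rightarrow> bool" where
  "maxplus_matrix A \<longleftrightarrow> (\<forall>i j. A $ i $ j \<noteq> \<infinity>)"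

definition maxplus_mult :: "ereal ^ 'n ^ 'n \<Rightarrow> ereal ^ 'n ^ 'n \<Rightarrow> ereal ^ 'n ^ 'n" where
  "maxplus_mult A B = (\<chi> i j. MAX h. A $ i $ h + B $ h $ j)"

definition maxplus_one :: "ereal ^ 'n ^ 'n" where
  "maxplus_one = (\<chi> i j. if i = j then 0 else - \<infinity>)"

primrec maxplus_power :: "ereal ^ 'n ^ 'n \<Rightarrow> nat \<Rightarrow> ereal ^ 'n ^ 'n" where
  "maxplus_power A 0 = maxplus_one"
| "maxplus_power A (Suc k) = maxplus_mult A (maxplus_power A k)"

definition maxplus_digraph :: "ereal ^ 'n ^ 'n \<Rightarrow> ('n, 'n \<times> 'n) pre_digraph" where
  "maxplus_digraph A =
    \<lparr>verts = UNIV, arcs = {(i, j). A $ i $ j \<noteq> - \<infinity>}, tail = fst, head = snd\<rparr>"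

definition irreducible_matrix :: "ereal ^ 'n ^ 'n \<Rightarrow> bool" where
  "irreducible_matrix A \<longleftrightarrow> strongly_connected (maxplus_digraph A)"

definition cycle_mean :: "ereal ^ 'n ^ 'n \<Rightarrow> ('n \<times> 'n) list \<Rightarrow> ereal" where
  "cycle_mean A c = (\<Sum>(i, j)\<leftarrow>c. A $ i $ j) / ereal (real (length c))"

definition cycle_means :: "ereal ^ 'n ^ 'n \<Rightarrow> ereal set" where
  "cycle_means A = {cycle_mean A c |c. pre_digraph.cycle (maxplus_digraph A) c}"

text \<open>
  The cycles of \<^const>\<open>pre_digraph.cycle\<close> are elementary (no repeated node, loops allowed), so a
  matrix with a finite index type has finitely many of them. Hence both suprema below are
  maxima, except that they equal \<^term>\<open>- \<infinity> :: ereal\<close> when they range over the empty set.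
  (With arbitrary closed walks a second largest mean need not exist.)
\<close>

definition max_cycle_mean :: "ereal ^ 'n ^ 'n \<Rightarrow> ereal" where
  "max_cycle_mean A = Sup (cycle_means A)"

definition second_cycle_mean :: "ereal ^ 'n ^ 'n \<Rightarrow> ereal" where
  "second_cycle_mean A = Sup {m \<in> cycle_means A. m < max_cycle_mean A}"

definition finite_entries :: "ereal ^ 'n ^ 'n \<Rightarrow> ereal set" where
  "finite_entries A = {A $ i $ j |i j. \<bar>A $ i $ j\<bar> \<noteq> \<infinity>}"

definition maxplus_spread :: "ereal ^ 'n ^ 'n \<Rightarrow> ereal" where
  "maxplus_spread A = Max (finite_entries A) - Min (finite_entries A)"

definition periodic_from :: "(nat \<Rightarrow> ereal ^ 'n ^ 'n) \<Rightarrow> nat \<Rightarrow> real \<Rightarrow> nat \<Rightarrow> bool" where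
  "periodic_from a p \<rho> K \<longleftrightarrow>
    (\<forall>k\<ge>K. \<forall>i j. a (k + p) $ i $ j = a k $ i $ j + ereal (real p * \<rho>))"

text \<open>
  The infimum of a nonempty set of \<^typ>\<open>enat\<close> is its least element; the transient of a sequence
  that is not eventually periodic is \<^term>\<open>\<infinity> :: enat\<close>.
\<close>

definition transient :: "(nat \<Rightarrow> ereal ^ 'n ^ 'n) \<Rightarrow> enat" where
  "transient a = Inf {enat K |K. \<exists>p\<ge>1. \<exists>\<rho>. periodic_from a p \<rho> K}"

end

theory Submission
  imports Defs
begin

text \<open>
  Subtract \<open>\<lambda>(A)\<close> from all entries, so that cycles have weight at most \<open>0\<close> and critical cycles have
  weight \<open>0\<close>. Let \<open>k, k' \<ge> 2n\<^sup>2 - 2\<close> be congruent modulo \<open>n!\<close>; then they are congruent modulo the length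
  \<open>l \<le> n\<close> of every critical cycle. A walk of length \<open>k\<close> through a node \<open>c\<close> of a critical cycle can be
  replaced by one of length \<open>k'\<close> of at least the same weight: delete closed subwalks of length divisible
  by \<open>l\<close> before and after \<open>c\<close> until at most \<open>2nl - 2\<close> arcs remain, then pad with the critical cycle.
  A walk of length \<open>k\<close> avoiding all critical nodes loses at least \<open>\<lambda>(A) - \<lambda>\<^sub>2(A)\<close> per arc, apart from an
  elementary path of at most \<open>n - 1\<close> arcs. For large \<open>k\<close> it is therefore lighter than any walk obtained by the
  same shortening and padding after a detour through a critical node. So \<open>n!\<close> is a period
  from the bound on.
\<close>

section \<open>Walks and their weights\<close>

text \<open>The list contains the nodes after the start node, so its length is the number of arcs.\<close>

fun walk :: "('a \<Rightarrow> 'a \<Rightarrow> bool) \<Rightarrow> 'a \<Rightarrow> 'a list \<Rightarrow> 'a \<Rightarrow> bool" where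
  "walk E i [] j \<longleftrightarrow> i = j"
| "walk E i (x # xs) j \<longleftrightarrow> E i x \<and> walk E x xs j"

fun weight :: "('a \<Rightarrow> 'a \<Rightarrow> real) \<Rightarrow> 'a \<Rightarrow> 'a list \<Rightarrow> real" where
  "weight f i [] = 0"
| "weight f i (x # xs) = f i x + weight f x xs"

text \<open>Since \<open>v\<close> is also the last element of \<open>xs\<close>,
  \<open>distinct xs\<close> already excludes every repeated node; a loop is
  \<open>xs = [v]\<close>.\<close>

definition elementary_cycle :: "('a \<Rightarrow> 'a \<Rightarrow> bool) \<Rightarrow> 'a \<Rightarrow> 'a list \<Rightarrow> bool" where
  "elementary_cycle E v xs \<longleftrightarrow> walk E v xs v \<and> distinct xs \<and> xs \<noteq> []"

lemma walk_append: "walk E i (xs @ ys) j \<longleftrightarrow> (\<exists>h. walk E i xs h \<and> walk E h ys j)"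
  by (induction xs arbitrary: i) auto

lemma walk_appendI: "walk E i xs h \<Longrightarrow> walk E h ys j \<Longrightarrow> walk E i (xs @ ys) j"
  by (auto simp: walk_append)

lemma weight_append: "walk E i xs h \<Longrightarrow> weight f i (xs @ ys) = weight f i xs + weight f h ys"
  by (induction xs arbitrary: i) auto

lemma weight_diff_const:
  "weight (\<lambda>i j. f i j - c) i xs = weight f i xs - c * real (length xs)"
  by (induction xs arbitrary: i) (auto simp: algebra_simps)

lemma weight_lower_bound:
  assumes "\<And>i j. E i j \<Longrightarrow> m \<le> f i j"
  shows "walk E i xs j \<Longrightarrow> m * real (length xs) \<le> weight f i xs"
  using assms by (induction xs arbitrary: i) (auto simp: algebra_simps intro: add_mono)

lemma weight_upper_bound:
  assumes "\<And>i j. E i j \<Longrightarrow> f i j \<le> M"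
  shows "walk E i xs j \<Longrightarrow> weight f i xs \<le> M * real (length xs)"
  using assms by (induction xs arbitrary: i) (auto simp: algebra_simps intro: add_mono)

lemma walk_take_drop:
  assumes "walk E i xs j" "a \<le> length xs"
  shows "walk E i (take a xs) ((i # xs) ! a)" "walk E ((i # xs) ! a) (drop a xs) j"
proof -
  have "walk E i (take a xs) ((i # xs) ! a) \<and> walk E ((i # xs) ! a) (drop a xs) j"
    using assms
  proof (induction xs arbitrary: i a)
    case Nil
    then show ?case by simp
  next
    case (Cons x xs)
    then show ?case by (cases a) auto
  qed
  then show "walk E i (take a xs) ((i # xs) ! a)" "walk E ((i # xs) ! a) (drop a xs) j"
    by auto
qed

lemma walk_vertex_split:
  assumes "walk E i xs j" "c \<in> set (i # xs)"
  obtains us vs where "xs = us @ vs" "walk E i us c" "walk E c vs j"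
proof -
  obtain a where "a < length (i # xs)" "(i # xs) ! a = c"
    using assms(2) by (meson in_set_conv_nth)
  with walk_take_drop[OF assms(1), of a] that[of "take a xs" "drop a xs"] show thesis
    by auto
qed

lemma walk_replicate:
  assumes "walk E v zs v"
  shows "walk E v (concat (replicate m zs)) v"
    and "weight f v (concat (replicate m zs)) = real m * weight f v zs"
    and "length (concat (replicate m zs)) = m * length zs"
proof -
  show "walk E v (concat (replicate m zs)) v"
    by (induction m) (auto intro: walk_appendI assms)
  show "weight f v (concat (replicate m zs)) = real m * weight f v zs"
    by (induction m) (auto simp: weight_append[OF assms] algebra_simps)
  show "length (concat (replicate m zs)) = m * length zs"
    by (induction m) auto
qed

section \<open>Loop erasure\<close>

text \<open>Arcs are added at the front. If the new start node \<open>i\<close> already lies on the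
  path erased so far, the part up to \<open>i\<close> closes an elementary cycle, because the rest
  of the path has no repetition; this cycle is dropped, and it weighed at most \<open>\<mu>\<close>
  per arc.\<close>

lemma loop_erasure:
  assumes cyc: "\<And>v xs. elementary_cycle E v xs \<Longrightarrow> weight f v xs \<le> \<mu> * real (length xs)"
    and "walk E i xs j"
  shows "\<exists>ys. walk E i ys j \<and> distinct (i # ys) \<and>
    weight f i xs \<le> weight f i ys + \<mu> * (real (length xs) - real (length ys))"
  using assms(2)
proof (induction xs arbitrary: i)
  case Nil
  then show ?case by (intro exI[of _ "[]"]) auto
next
  case (Cons x xs)
  then obtain ys where ys: "walk E x ys j" "distinct (x # ys)"
    "weight f x xs \<le> weight f x ys + \<mu> * (real (length xs) - real (length ys))"
    by auto
  show ?case
  proof (cases "i \<in> set (x # ys)")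
    case False
    with ys Cons.prems show ?thesis
      by (intro exI[of _ "x # ys"]) auto
  next
    case True
    then obtain us vs where s: "x # ys = us @ i # vs"
      by (meson split_list)
    have w: "walk E i (x # ys) j"
      using ys(1) Cons.prems by simp
    from w have w1: "walk E i (us @ [i]) i" and w2: "walk E i vs j"
      unfolding s by (auto simp: walk_append)
    have "elementary_cycle E i (us @ [i])"
      using w1 ys(2) unfolding elementary_cycle_def s by auto
    from cyc[OF this] have c: "weight f i (us @ [i]) \<le> \<mu> * (real (length us) + 1)"
      by (simp add: add.commute)
    have "weight f i (x # ys) = weight f i (us @ [i]) + weight f i vs"
      unfolding s using weight_append[OF w1, of f vs] by simp
    moreover have "length ys = length us + length vs"
      using arg_cong[OF s, of length] by simp
    ultimately have "weight f i (x # xs) \<le>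
        weight f i vs + \<mu> * (real (length (x # xs)) - real (length vs))"
      using ys(3) c by (simp add: algebra_simps)
    with w2 ys(2) show ?thesis
      unfolding s by (intro exI[of _ vs]) auto
  qed
qed

text \<open>Loop erasure turns a closed walk into a path from \<open>v\<close> to \<open>v\<close>
  without repeated nodes, which is empty; all the weight was in erased cycles.\<close>

lemma closed_walk_weight:
  assumes "\<And>v xs. elementary_cycle E v xs \<Longrightarrow> weight f v xs \<le> \<mu> * real (length xs)"
    and "walk E v xs v"
  shows "weight f v xs \<le> \<mu> * real (length xs)"
proof -
  obtain ys where ys: "walk E v ys v" "distinct (v # ys)"
    "weight f v xs \<le> weight f v ys + \<mu> * (real (length xs) - real (length ys))"
    using loop_erasure[OF assms] by blast
  have "last (v # ys) = v"
    using ys(1) by (induction ys arbitrary: v rule: rev_induct) (auto simp: walk_append)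
  then have "ys = []"
    using ys(2) by (metis distinct.simps(2) last.simps last_in_set)
  with ys(3) show ?thesis by simp
qed

text \<open>Without elementary cycles, the bound for closed walks holds with
  \<open>\<mu> = 0\<close> for every weight function; with all weights \<open>1\<close> it bounds
  the length by \<open>0\<close>.\<close>

lemma closed_walk_contains_cycle:
  assumes "walk E v xs v" "xs \<noteq> []"
  shows "\<exists>u ys. elementary_cycle E u ys"
proof (rule ccontr)
  assume "\<nexists>u ys. elementary_cycle E u ys"
  then have "weight (\<lambda>_ _. 1) v xs \<le> 0 * real (length xs)"
    by (intro closed_walk_weight[OF _ assms(1)]) auto
  moreover have "1 * real (length xs) \<le> weight (\<lambda>_ _. 1) v xs"
    by (rule weight_lower_bound[OF _ assms(1)]) auto
  ultimately show False using assms(2) by (cases xs) auto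
qed

section \<open>Changing the length of a walk within a residue class\<close>

text \<open>Pigeonhole on the pairs of a vertex and the time of its visit modulo \<open>l\<close>.\<close>

lemma shorten_mod:
  fixes E :: "'a::finite \<Rightarrow> 'a \<Rightarrow> bool"
  assumes closed: "\<And>v xs. walk E v xs v \<Longrightarrow> weight f v xs \<le> 0"
    and "walk E i xs j" "l > 0"
  shows "\<exists>ys. walk E i ys j \<and> length ys < CARD('a) * l \<and>
    length ys mod l = length xs mod l \<and> weight f i xs \<le> weight f i ys"
  using assms(2)
proof (induction xs rule: length_induct)
  case (1 xs)
  show ?case
  proof (cases "length xs < CARD('a) * l")
    case True
    with 1 show ?thesis by blast
  next
    case False
    let ?g = "\<lambda>t. ((i # xs) ! t, t mod l)"
    have "?g ` {..length xs} \<subseteq> (UNIV :: 'a set) \<times> {..<l}"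
      using \<open>l > 0\<close> by auto
    then have "card (?g ` {..length xs}) \<le> card ((UNIV :: 'a set) \<times> {..<l})"
      by (intro card_mono) auto
    also have "\<dots> < card {..length xs}"
      using False by (simp add: card_cartesian_product)
    finally have "\<not> inj_on ?g {..length xs}"
      by (rule pigeonhole)
    then obtain a b where ab: "a < b" "b \<le> length xs" "(i # xs) ! a = (i # xs) ! b"
      "a mod l = b mod l"
      unfolding inj_on_def by (smt (verit, ccfv_threshold) Pair_inject atMost_iff linorder_neqE_nat)
    define v where "v = (i # xs) ! a"
    define us where "us = take a xs"
    define cs where "cs = drop a (take b xs)"
    define ws where "ws = drop b xs"
    have us: "walk E i us v"
      using walk_take_drop(1)[OF 1(2), of a] ab by (simp add: us_def v_def)
    have ws: "walk E v ws j"
      using walk_take_drop(2)[OF 1(2), of b] ab by (simp add: ws_def v_def)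
    have b: "walk E i (take b xs) v"
      using walk_take_drop(1)[OF 1(2), of b] ab by (simp add: v_def)
    have "(i # take b xs) ! a = v"
      using ab by (cases a) (auto simp: v_def)
    then have cs: "walk E v cs v"
      using walk_take_drop(2)[OF b, of a] ab by (simp add: cs_def)
    have "take b xs = us @ cs"
      using ab by (metis us_def cs_def append_take_drop_id min.absorb1 order_less_imp_le take_take)
    then have xs: "xs = us @ cs @ ws"
      unfolding ws_def by (metis append_assoc append_take_drop_id)
    have "length cs = b - a"
      using ab by (simp add: cs_def)
    then have len: "length cs > 0" "length cs mod l = 0"
      using ab mod_eq_dvd_iff_nat[of a b l] by auto
    have "walk E i (us @ ws) j"
      using us ws by (rule walk_appendI)
    moreover have "length (us @ ws) < length xs"
      using len(1) unfolding xs by simp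
    ultimately obtain ys where ys: "walk E i ys j" "length ys < CARD('a) * l"
      "length ys mod l = length (us @ ws) mod l" "weight f i (us @ ws) \<le> weight f i ys"
      using 1(1) by blast
    obtain q where "length cs = l * q"
      using len(2) by (metis dvdE mod_0_imp_dvd)
    then have "length xs = length (us @ ws) + l * q"
      unfolding xs by simp
    then have "length xs mod l = length (us @ ws) mod l"
      by simp
    \<comment> \<open>The deleted subwalk is closed and so has weight at most \<open>0\<close>; the
      deletion cannot lower the weight.\<close>
    moreover have "weight f i xs \<le> weight f i (us @ ws)"
      using closed[OF cs] unfolding xs
      by (simp add: weight_append[OF us] weight_append[OF cs])
    ultimately show ?thesis using ys by auto
  qed
qed

text \<open>Follow any return walk, then go around the resulting closed walk \<open>l - 1\<close> times.\<close>

lemma return_walk_mod: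
  assumes conn: "\<And>i j. \<exists>xs. walk E i xs j"
    and "walk E i us c" "l > 0"
  shows "\<exists>vs. walk E c vs i \<and> l dvd length us + length vs"
proof -
  obtain rs where rs: "walk E c rs i"
    using conn by blast
  have loop: "walk E i (us @ rs) i"
    using assms(2) rs by (rule walk_appendI)
  let ?vs = "rs @ concat (replicate (l - 1) (us @ rs))"
  have "length us + length ?vs = length (us @ rs) + (l - 1) * length (us @ rs)"
    using walk_replicate(3)[OF loop, where m = "l - 1"] by simp
  also have "\<dots> = l * length (us @ rs)"
    using \<open>l > 0\<close> by (metis Suc_pred' mult_Suc)
  finally have "l dvd length us + length ?vs" by simp
  moreover have "walk E c ?vs i"
    using rs walk_replicate(1)[OF loop] by (rule walk_appendI)
  ultimately show ?thesis by blast
qed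

text \<open>The missing arcs number a multiple of \<open>length zs\<close>, so going around
  \<open>zs\<close> at \<open>c\<close> supplies them without changing the weight.\<close>

lemma pad_walk:
  assumes "walk E i us c" "walk E c vs j" "walk E c zs c" "weight f c zs = 0"
    and "length us + length vs \<le> k" "(length us + length vs) mod length zs = k mod length zs"
  shows "\<exists>ys. walk E i ys j \<and> length ys = k \<and> weight f i ys = weight f i us + weight f c vs"
proof -
  obtain m where m: "k = length us + length vs + length zs * m"
    using assms(5,6) by (metis mod_eq_nat1E)
  let ?cs = "concat (replicate m zs)"
  have cs: "walk E c ?cs c" "weight f c ?cs = 0" "length ?cs = m * length zs"
    using walk_replicate[OF assms(3), where m = m] assms(4) by auto
  have "walk E i (us @ ?cs @ vs) j"
    using assms(1,2) cs(1) by (intro walk_appendI)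
  moreover have "length (us @ ?cs @ vs) = k"
    using cs(3) m by (simp add: mult.commute)
  moreover have "weight f i (us @ ?cs @ vs) = weight f i us + weight f c vs"
    using cs(2) by (simp add: weight_append[OF assms(1)] weight_append[OF cs(1)])
  ultimately show ?thesis by blast
qed

section \<open>Exchanging walks of congruent lengths\<close>

text \<open>The two halves are shortened separately, which keeps \<open>c\<close> on the walk as the
  place to insert \<open>zs\<close>. The modulus \<open>fact CARD('a)\<close> is a common multiple
  of all elementary cycle lengths. The second bound does not depend on the weights of
  \<open>us\<close> and \<open>vs\<close>; it serves walks that reach \<open>c\<close> only by an
  arbitrary detour.\<close>

lemma reroute_via_critical:
  fixes E :: "'a::finite \<Rightarrow> 'a \<Rightarrow> bool"
  assumes cyc: "\<And>v xs. elementary_cycle E v xs \<Longrightarrow> weight f v xs \<le> 0"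
    and lower: "\<And>i j. E i j \<Longrightarrow> m \<le> f i j" and "m \<le> 0"
    and crit: "elementary_cycle E c zs" "weight f c zs = 0"
    and "walk E i us c" "walk E c vs j"
    and cong: "(length us + length vs) mod fact CARD('a) = k mod fact CARD('a)"
    and k: "k + 2 \<ge> 2 * CARD('a)\<^sup>2"
  shows "\<exists>ys. walk E i ys j \<and> length ys = k \<and> weight f i us + weight f c vs \<le> weight f i ys
    \<and> m * (2 * real CARD('a) ^ 2 - 2) \<le> weight f i ys"
proof -
  let ?n = "CARD('a)" and ?l = "length zs"
  have zs: "walk E c zs c" "distinct zs" "?l > 0"
    using crit(1) by (auto simp: elementary_cycle_def)
  have "?l \<le> ?n"
    using zs(2) by (metis card_mono distinct_card finite subset_UNIV)
  then have dvd: "?l dvd fact ?n"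
    using zs(3) by (intro dvd_fact) (auto simp: Suc_le_eq)
  have closed: "weight f v xs \<le> 0" if "walk E v xs v" for v xs
    using closed_walk_weight[where \<mu> = 0, OF _ that] cyc by auto
  obtain us' where us': "walk E i us' c" "length us' < ?n * ?l"
    "length us' mod ?l = length us mod ?l" "weight f i us \<le> weight f i us'"
    using shorten_mod[OF closed \<open>walk E i us c\<close> zs(3)] by auto
  obtain vs' where vs': "walk E c vs' j" "length vs' < ?n * ?l"
    "length vs' mod ?l = length vs mod ?l" "weight f c vs \<le> weight f c vs'"
    using shorten_mod[OF closed \<open>walk E c vs j\<close> zs(3)] by auto
  have "?n * ?l \<le> ?n\<^sup>2"
    using \<open>?l \<le> ?n\<close> by (simp add: power2_eq_square)
  \<comment> \<open>Each half has at most \<open>?n * ?l - 1\<close> arcs; the two units saved are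
    the \<open>+ 2\<close>.\<close>
  with us'(2) vs'(2) have len: "length us' + length vs' + 2 \<le> 2 * ?n\<^sup>2"
    by linarith
  have "(length us' + length vs') mod ?l = (length us + length vs) mod ?l"
    using us'(3) vs'(3) by (metis mod_add_eq)
  also have "\<dots> = k mod ?l"
    using cong dvd by (metis mod_mod_cancel)
  finally obtain ys where ys: "walk E i ys j" "length ys = k"
    "weight f i ys = weight f i us' + weight f c vs'"
    using pad_walk[OF us'(1) vs'(1) zs(1) crit(2), of k] len k by auto
  have "real (length us' + length vs' + 2) \<le> real (2 * ?n\<^sup>2)"
    using len by (simp only: of_nat_le_iff)
  then have "real (length us') + real (length vs') \<le> 2 * real ?n ^ 2 - 2"
    by simp
  \<comment> \<open>Only the arcs outside the inserted cycle count, and since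
    \<open>m \<le> 0\<close> an upper bound on their number bounds the weight from below.\<close>
  then have "m * (2 * real ?n ^ 2 - 2) \<le> m * (real (length us') + real (length vs'))"
    using \<open>m \<le> 0\<close> by (rule mult_left_mono_neg)
  also have "\<dots> \<le> weight f i ys"
    using weight_lower_bound[of E m f, OF _ us'(1)] weight_lower_bound[of E m f, OF _ vs'(1)] lower ys(3)
    by (simp add: algebra_simps)
  finally show ?thesis
    using ys us'(4) vs'(4) by auto
qed

text \<open>The requirements differ: \<open>k\<close> must be long enough for a walk avoiding
  critical nodes to lose enough weight, \<open>k'\<close> long enough to hold a shortened walk.
  Neither is assumed to be the larger one, so the lemma can be applied in both directions.\<close>

lemma walk_transfer:
  fixes E :: "'a::finite \<Rightarrow> 'a \<Rightarrow> bool"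
  assumes conn: "\<And>i j. \<exists>xs. walk E i xs j"
    and cyc: "\<And>v xs. elementary_cycle E v xs \<Longrightarrow> weight f v xs \<le> 0"
    and gap: "\<And>v xs. elementary_cycle E v xs \<Longrightarrow> weight f v xs < 0 \<Longrightarrow>
      weight f v xs \<le> - \<delta> * real (length xs)"
    and crit: "elementary_cycle E c zs" "weight f c zs = 0"
    and lower: "\<And>i j. E i j \<Longrightarrow> m \<le> f i j" and "m \<le> 0"
    and upper: "\<And>i j. E i j \<Longrightarrow> f i j \<le> M" and "0 \<le> M"
    and "0 \<le> \<delta>"
    and k: "2 * real CARD('a) ^ 2 * (M - m) \<le> (real k - real CARD('a) + 1) * \<delta>"
    and k': "k' + 2 \<ge> 2 * CARD('a)\<^sup>2"
    and cong: "k mod fact CARD('a) = k' mod fact CARD('a)"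
    and xs: "walk E i xs j" "length xs = k"
  shows "\<exists>ys. walk E i ys j \<and> length ys = k' \<and> weight f i xs \<le> weight f i ys"
proof -
  define critical where "critical v \<longleftrightarrow> (\<exists>zs. elementary_cycle E v zs \<and> weight f v zs = 0)" for v
  let ?n = "CARD('a)"
  have reroute: "\<exists>ys. walk E i ys j \<and> length ys = k' \<and>
      weight f i us + weight f v vs \<le> weight f i ys \<and> m * (2 * real ?n ^ 2 - 2) \<le> weight f i ys"
    if "critical v" "walk E i us v" "walk E v vs j"
      "(length us + length vs) mod fact ?n = k' mod fact ?n" for us vs v
  proof -
    obtain zs' where "elementary_cycle E v zs'" "weight f v zs' = 0"
      using \<open>critical v\<close> unfolding critical_def by blast
    from reroute_via_critical[OF cyc lower \<open>m \<le> 0\<close> this that(2-4) k'] show ?thesis .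
  qed
  show ?thesis
  proof (cases "\<exists>v \<in> set (i # xs). critical v")
    case True
    then obtain v where v: "v \<in> set (i # xs)" "critical v"
      by blast
    obtain us vs where uv: "xs = us @ vs" "walk E i us v" "walk E v vs j"
      using walk_vertex_split[OF xs(1) v(1)] by blast
    have "(length us + length vs) mod fact ?n = k' mod fact ?n"
      using xs(2) uv(1) cong by simp
    from reroute[OF v(2) uv(2,3) this] show ?thesis
      using weight_append[OF uv(2), of f vs] uv(1) by auto
  next
    case False
    \<comment> \<open>Arcs must leave non-critical nodes. A cycle of \<open>?F\<close> therefore
      starts at a non-critical node, has negative weight and falls under \<open>gap\<close>.\<close>
    let ?F = "\<lambda>u v. E u v \<and> \<not> critical u"
    have F: "walk ?F i xs j"
      using xs(1) False by (induction xs arbitrary: i) auto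
    have cycF: "weight f v ys \<le> - \<delta> * real (length ys)" if "elementary_cycle ?F v ys" for v ys
    proof -
      have E: "walk E u ys w" if "walk ?F u ys w" for u w
        using that by (induction ys arbitrary: u) auto
      have "elementary_cycle E v ys"
        using that E by (auto simp: elementary_cycle_def)
      moreover have "\<not> critical v"
        using that by (cases ys) (auto simp: elementary_cycle_def)
      ultimately show ?thesis
        using cyc[of v ys] gap[of v ys] unfolding critical_def by force
    qed
    \<comment> \<open>Erasure inside \<open>?F\<close> has \<open>\<mu> = - \<delta>\<close>: every
      erased arc costs at least \<open>\<delta>\<close> on average.\<close>
    obtain ys where ys: "walk ?F i ys j" "distinct (i # ys)"
      "weight f i xs \<le> weight f i ys - \<delta> * (real k - real (length ys))"
      using loop_erasure[OF cycF F] xs(2) by auto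
    have "length (i # ys) \<le> ?n"
      using ys(2) by (metis card_mono distinct_card finite subset_UNIV)
    then have len: "real (length ys) \<le> real ?n - 1"
      by simp
    have "weight f i ys \<le> M * real (length ys)"
      using upper by (intro weight_upper_bound[OF _ ys(1)]) auto
    also have "\<dots> \<le> M * (real ?n - 1)"
      using len \<open>0 \<le> M\<close> by (rule mult_left_mono)
    finally have "weight f i xs \<le> M * (real ?n - 1) - \<delta> * (real k - real (length ys))"
      using ys(3) by linarith
    also have "\<dots> \<le> M * (real ?n - 1) - \<delta> * (real k - real ?n + 1)"
      using mult_left_mono[OF len \<open>0 \<le> \<delta>\<close>] by (simp add: algebra_simps)
    \<comment> \<open>The assumed lower bound on \<open>k\<close> enters here.\<close>
    also have "\<dots> \<le> M * (real ?n - 1) - 2 * real ?n ^ 2 * (M - m)"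
      using k by (simp add: mult.commute)
    also have "\<dots> \<le> m * (2 * real ?n ^ 2 - 2)"
    proof -
      have "real ?n \<le> real ?n ^ 2"
        by (simp add: power2_eq_square Suc_le_eq)
      then have "real ?n - 1 \<le> 2 * real ?n ^ 2"
        by linarith
      \<comment> \<open>The possible gain on the remaining path is absorbed by the \<open>M\<close>
        part of the loss; what is left is \<open>2 * real ?n ^ 2 * m\<close>, which suffices as
        \<open>m \<le> 0\<close>.\<close>
      then have "M * (real ?n - 1) \<le> M * (2 * real ?n ^ 2)"
        using \<open>0 \<le> M\<close> by (rule mult_left_mono)
      with \<open>m \<le> 0\<close> show ?thesis by (simp add: algebra_simps)
    qed
    finally have w: "weight f i xs \<le> m * (2 * real ?n ^ 2 - 2)" .
    \<comment> \<open>A detour from \<open>i\<close> to \<open>c\<close> and back, of length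
      divisible by \<open>fact ?n\<close>, is put in front of \<open>xs\<close>. It may be very
      light, but only the uniform lower bound from \<open>reroute\<close> is used.\<close>
    obtain us where us: "walk E i us c"
      using conn by blast
    obtain vs where vs: "walk E c vs i" "fact ?n dvd length us + length vs"
      using return_walk_mod[OF conn us, of "fact ?n"] by auto
    have walk: "walk E c (vs @ xs) j"
      using vs(1) xs(1) by (rule walk_appendI)
    obtain q where "length us + length vs = fact ?n * q"
      using vs(2) by (rule dvdE)
    then have "length us + length (vs @ xs) = k + fact ?n * q"
      using xs(2) by simp
    then have "(length us + length (vs @ xs)) mod fact ?n = k' mod fact ?n"
      using cong by (simp only: mod_mult_self2)
    moreover have "critical c"
      using crit critical_def by blast
    ultimately obtain ys where "walk E i ys j" "length ys = k'"
      "m * (2 * real ?n ^ 2 - 2) \<le> weight f i ys"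
      using reroute[OF _ us walk] by blast
    with w show ?thesis by (intro exI[of _ ys]) simp
  qed
qed

section \<open>Max-plus powers as maximal walk weights\<close>

abbreviation arc :: "ereal ^ 'n ^ 'n \<Rightarrow> 'n \<Rightarrow> 'n \<Rightarrow> bool" where
  "arc A i j \<equiv> A $ i $ j \<noteq> - \<infinity>"

text \<open>Real weights allow subtraction. The value \<open>0\<close> of \<open>entry\<close> at a
  missing arc is harmless, as weights are only taken along walks of \<open>arc A\<close>.\<close>

abbreviation entry :: "ereal ^ 'n ^ 'n \<Rightarrow> 'n \<Rightarrow> 'n \<Rightarrow> real" where
  "entry A i j \<equiv> real_of_ereal (A $ i $ j)"

lemma ereal_entry:
  assumes "maxplus_matrix A" "arc A i j"
  shows "A $ i $ j = ereal (entry A i j)"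
  using assms by (cases "A $ i $ j") (auto simp: maxplus_matrix_def)

text \<open>With \<open>maxplus_power_attained\<close>, this makes each finite entry of the power
  the greatest weight of a walk of that length.\<close>

lemma weight_le_maxplus_power:
  assumes "maxplus_matrix A"
  shows "walk (arc A) i xs j \<Longrightarrow>
    ereal (weight (entry A) i xs) \<le> maxplus_power A (length xs) $ i $ j"
proof (induction xs arbitrary: i)
  case Nil
  then show ?case by (simp add: maxplus_one_def zero_ereal_def)
next
  case (Cons x xs)
  have "ereal (weight (entry A) i (x # xs)) = A $ i $ x + ereal (weight (entry A) x xs)"
    using Cons.prems ereal_entry[OF assms, of i x] by (simp flip: plus_ereal.simps(1))
  also have "\<dots> \<le> A $ i $ x + maxplus_power A (length xs) $ x $ j"
    using Cons by (intro add_left_mono) auto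
  also have "\<dots> \<le> maxplus_power A (length (x # xs)) $ i $ j"
    by (auto simp: maxplus_mult_def intro!: Max_ge)
  finally show ?case .
qed

lemma maxplus_power_attained:
  fixes A :: "ereal ^ 'n ^ 'n"
  assumes "maxplus_matrix A"
  shows "maxplus_power A k $ i $ j \<noteq> - \<infinity> \<Longrightarrow> \<exists>xs. walk (arc A) i xs j \<and> length xs = k \<and>
    maxplus_power A k $ i $ j = ereal (weight (entry A) i xs)"
proof (induction k arbitrary: i)
  case 0
  then have "i = j"
    by (auto simp: maxplus_one_def split: if_splits)
  then show ?case
    by (intro exI[of _ "[]"]) (auto simp: maxplus_one_def zero_ereal_def)
next
  case (Suc k)
  let ?P = "maxplus_power A k"
  have "maxplus_power A (Suc k) $ i $ j \<in> range (\<lambda>h. A $ i $ h + ?P $ h $ j)"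
    unfolding maxplus_power.simps maxplus_mult_def vec_lambda_beta by (intro Max_in) auto
  then obtain h where h: "maxplus_power A (Suc k) $ i $ j = A $ i $ h + ?P $ h $ j"
    by auto
  \<comment> \<open>By the induction hypothesis an entry other than \<open>- \<infinity>\<close> is
    a real weight. This excludes \<open>- \<infinity> + \<infinity> = \<infinity>\<close> in
    \<open>ereal\<close>.\<close>
  have "?P $ h $ j \<noteq> \<infinity>"
    using Suc.IH[of h] by force
  with Suc.prems h assms have "arc A i h" "?P $ h $ j \<noteq> - \<infinity>"
    by (auto simp: maxplus_matrix_def)
  with Suc.IH[of h] obtain xs where "walk (arc A) h xs j" "length xs = k"
    "?P $ h $ j = ereal (weight (entry A) h xs)"
    by auto
  with h \<open>arc A i h\<close> ereal_entry[OF assms, of i h] show ?case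
    by (intro exI[of _ "h # xs"]) (auto simp flip: plus_ereal.simps(1))
qed

text \<open>Transfer from \<open>k\<close> to \<open>k + p\<close> and from \<open>k + p\<close> to
  \<open>k\<close> gives the two inequalities; subtracting \<open>\<rho>\<close> per arc accounts
  for the ratio.\<close>

lemma periodic_from_maxplus_power:
  assumes "maxplus_matrix A"
    and transfer: "\<And>k k' i j xs. k \<ge> K \<Longrightarrow> k' \<ge> K \<Longrightarrow> k mod p = k' mod p \<Longrightarrow>
      walk (arc A) i xs j \<Longrightarrow> length xs = k \<Longrightarrow>
      \<exists>ys. walk (arc A) i ys j \<and> length ys = k' \<and>
        weight (entry A) i xs - \<rho> * real k \<le> weight (entry A) i ys - \<rho> * real k'"
  shows "periodic_from (maxplus_power A) p \<rho> K"
  unfolding periodic_from_def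
proof (intro allI impI)
  fix k i j assume "K \<le> k"
  have le: "maxplus_power A k1 $ i $ j + ereal (\<rho> * (real k2 - real k1))
      \<le> maxplus_power A k2 $ i $ j"
    if k: "k1 \<ge> K" "k2 \<ge> K" "k1 mod p = k2 mod p" for k1 k2
  proof (cases "maxplus_power A k1 $ i $ j = - \<infinity>")
    case True
    then show ?thesis by simp
  next
    case False
    then obtain xs where xs: "walk (arc A) i xs j" "length xs = k1"
      "maxplus_power A k1 $ i $ j = ereal (weight (entry A) i xs)"
      using maxplus_power_attained[OF assms(1)] by blast
    then obtain ys where ys: "walk (arc A) i ys j" "length ys = k2"
      "weight (entry A) i xs - \<rho> * real k1 \<le> weight (entry A) i ys - \<rho> * real k2"
      using transfer[OF k xs(1,2)] by auto
    have "maxplus_power A k1 $ i $ j + ereal (\<rho> * (real k2 - real k1))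
        \<le> ereal (weight (entry A) i ys)"
      using xs(3) ys(3) by (simp add: algebra_simps)
    also have "\<dots> \<le> maxplus_power A k2 $ i $ j"
      using weight_le_maxplus_power[OF assms(1) ys(1)] ys(2) by simp
    finally show ?thesis .
  qed
  have "maxplus_power A k $ i $ j + ereal (real p * \<rho>) \<le> maxplus_power A (k + p) $ i $ j"
    using le[of k "k + p"] \<open>K \<le> k\<close> by (simp add: mult.commute)
  moreover have "maxplus_power A (k + p) $ i $ j \<le> maxplus_power A k $ i $ j + ereal (real p * \<rho>)"
  proof -
    have "maxplus_power A (k + p) $ i $ j + ereal (- (real p * \<rho>)) \<le> maxplus_power A k $ i $ j"
      using le[of "k + p" k] \<open>K \<le> k\<close> by (simp add: mult.commute)
    then show ?thesis
      by (cases "maxplus_power A (k + p) $ i $ j"; cases "maxplus_power A k $ i $ j") auto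
  qed
  ultimately show "maxplus_power A (k + p) $ i $ j = maxplus_power A k $ i $ j + ereal (real p * \<rho>)"
    by (rule order.antisym[rotated])
qed

section \<open>Walks, cycles and cycle means of the digraph of a matrix\<close>

lemma irreducible_matrix_walk:
  assumes "irreducible_matrix A"
  shows "\<exists>xs. walk (arc A) i xs j"
proof -
  have "(i, j) \<in> rtrancl_on UNIV (arcs_ends (maxplus_digraph A))"
    using assms
    by (simp add: irreducible_matrix_def strongly_connected_def reachable_def maxplus_digraph_def)
  then show ?thesis
  proof (induction rule: rtrancl_on.induct)
    case (rtrancl_on_refl a)
    show ?case by (rule exI[of _ "[]"]) simp
  next
    case (rtrancl_on_into_rtrancl_on a b c)
    then obtain xs where "walk (arc A) a xs b" by blast
    moreover have "walk (arc A) b [c] c"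
      using rtrancl_on_into_rtrancl_on(2)
      by (auto simp: arcs_ends_def arc_to_ends_def maxplus_digraph_def)
    ultimately show ?case by (blast intro: walk_appendI)
  qed
qed

text \<open>Library walks are lists of arcs. Zipping the node list \<open>u # xs\<close> with its
  tail yields the arcs, as \<open>zip\<close> ignores the surplus last node.\<close>

lemma awalk_zip:
  "pre_digraph.awalk (maxplus_digraph A) u (zip (u # xs) xs) v \<longleftrightarrow> walk (arc A) u xs v"
  by (induction xs arbitrary: u)
    (auto simp: pre_digraph.awalk_def pre_digraph.cas.simps maxplus_digraph_def)

lemma awalk_verts_zip:
  "pre_digraph.awalk_verts (maxplus_digraph A) u (zip (u # xs) xs) = u # xs"
  by (induction xs arbitrary: u)
    (auto simp: pre_digraph.awalk_verts.simps maxplus_digraph_def)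

lemma awalk_eq_zip:
  assumes "pre_digraph.awalk (maxplus_digraph A) u p v"
  shows "p = zip (u # map snd p) (map snd p)"
proof -
  have "pre_digraph.cas (maxplus_digraph A) u p v"
    using assms by (simp add: pre_digraph.awalk_def)
  then show ?thesis
    by (induction p arbitrary: u) (auto simp: pre_digraph.cas.simps maxplus_digraph_def)
qed

text \<open>The library demands distinctness of the tail of the node list \<open>v # xs\<close>,
  which is \<open>xs\<close>.\<close>

lemma cycle_iff_elementary_cycle:
  "pre_digraph.cycle (maxplus_digraph A) p \<longleftrightarrow>
    (\<exists>v xs. elementary_cycle (arc A) v xs \<and> p = zip (v # xs) xs)"
proof
  assume "pre_digraph.cycle (maxplus_digraph A) p"
  then obtain u where u: "pre_digraph.awalk (maxplus_digraph A) u p u"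
    "distinct (tl (pre_digraph.awalk_verts (maxplus_digraph A) u p))" "p \<noteq> []"
    by (auto simp: pre_digraph.cycle_def)
  obtain xs where p: "p = zip (u # xs) xs"
    using awalk_eq_zip[OF u(1)] by blast
  have "elementary_cycle (arc A) u xs"
    using u unfolding p elementary_cycle_def awalk_zip awalk_verts_zip by auto
  with p show "\<exists>v xs. elementary_cycle (arc A) v xs \<and> p = zip (v # xs) xs"
    by blast
next
  assume "\<exists>v xs. elementary_cycle (arc A) v xs \<and> p = zip (v # xs) xs"
  then obtain v xs where vx: "elementary_cycle (arc A) v xs" "p = zip (v # xs) xs"
    by blast
  then have "p \<noteq> []"
    by (cases xs) (auto simp: elementary_cycle_def)
  with vx show "pre_digraph.cycle (maxplus_digraph A) p"
    unfolding pre_digraph.cycle_def elementary_cycle_def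
    by (intro exI[of _ v]) (simp add: awalk_zip awalk_verts_zip)
qed

lemma cycle_mean_zip:
  assumes "maxplus_matrix A" "elementary_cycle (arc A) v xs"
  shows "cycle_mean A (zip (v # xs) xs) = ereal (weight (entry A) v xs / real (length xs))"
proof -
  have "(\<Sum>(i, j)\<leftarrow>zip (v # xs) xs. A $ i $ j) = ereal (weight (entry A) v xs)"
    if "walk (arc A) v xs w" for w
    using that
  proof (induction xs arbitrary: v)
    case Nil
    then show ?case by (simp add: zero_ereal_def)
  next
    case (Cons x xs)
    then show ?case
      using ereal_entry[OF assms(1), of v x] by (simp flip: plus_ereal.simps(1))
  qed
  then show ?thesis
    using assms(2) by (auto simp: cycle_mean_def elementary_cycle_def)
qed

lemma cycle_means_eq:
  assumes "maxplus_matrix A"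
  shows "cycle_means A = (\<lambda>(v, xs). ereal (weight (entry A) v xs / real (length xs))) `
    {(v, xs). elementary_cycle (arc A) v xs}"
  unfolding cycle_means_def cycle_iff_elementary_cycle
  by (force simp: cycle_mean_zip[OF assms])

lemma finite_cycle_means:
  fixes A :: "ereal ^ 'n ^ 'n"
  assumes "maxplus_matrix A"
  shows "finite (cycle_means A)"
proof -
  have "finite {xs :: 'n list. set xs \<subseteq> UNIV \<and> distinct xs}"
    by (rule finite_subset_distinct) simp
  then have "finite ((UNIV :: 'n set) \<times> {xs :: 'n list. set xs \<subseteq> UNIV \<and> distinct xs})"
    by simp
  then have "finite {(v :: 'n, xs). elementary_cycle (arc A) v xs}"
    by (rule finite_subset[rotated]) (auto simp: elementary_cycle_def)
  then show ?thesis
    unfolding cycle_means_eq[OF assms] by (rule finite_imageI)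
qed

section \<open>Bounds on the transient\<close>

lemma transient_le:
  assumes "periodic_from a p \<rho> K" "p \<ge> 1"
  shows "transient a \<le> enat K"
  unfolding transient_def using assms by (intro Inf_lower) auto

text \<open>Subtracting \<open>\<rho>\<close> from all entries reduces this to
  \<open>walk_transfer\<close>. The gap \<open>\<delta>\<close> stays a parameter, so that matrices
  without a second cycle mean are covered too.\<close>

lemma transient_le_of_gap:
  fixes A :: "ereal ^ 'n ^ 'n"
  assumes A: "maxplus_matrix A" "irreducible_matrix A"
    and cyc: "\<And>v xs. elementary_cycle (arc A) v xs \<Longrightarrow>
      weight (entry A) v xs \<le> \<rho> * real (length xs)"
    and gap: "\<And>v xs. elementary_cycle (arc A) v xs \<Longrightarrow>
      weight (entry A) v xs < \<rho> * real (length xs) \<Longrightarrow>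
      weight (entry A) v xs \<le> (\<rho> - \<delta>) * real (length xs)"
    and crit: "elementary_cycle (arc A) c zs" "weight (entry A) c zs = \<rho> * real (length zs)"
    and entries: "\<And>i j. arc A i j \<Longrightarrow> m \<le> entry A i j" "\<And>i j. arc A i j \<Longrightarrow> entry A i j \<le> M"
    and "0 \<le> \<delta>"
    and K: "2 * real CARD('n) ^ 2 * (M - m) \<le> (real K - real CARD('n) + 1) * \<delta>"
      "2 * CARD('n)\<^sup>2 \<le> K"
  shows "transient (maxplus_power A) \<le> enat K"
proof (rule transient_le)
  let ?f = "\<lambda>i j. entry A i j - \<rho>"
  have zs: "walk (arc A) c zs c" "real (length zs) > 0"
    using crit(1) by (auto simp: elementary_cycle_def)
  have "m * real (length zs) \<le> \<rho> * real (length zs)" "\<rho> * real (length zs) \<le> M * real (length zs)"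
    using weight_lower_bound[of "arc A" m "entry A", OF _ zs(1)]
      weight_upper_bound[of "arc A" "entry A" M, OF _ zs(1)] entries crit(2) by auto
  \<comment> \<open>The mean \<open>\<rho>\<close> of a critical cycle lies between the bounds for
    the entries.\<close>
  then have "m - \<rho> \<le> 0" "0 \<le> M - \<rho>"
    using zs(2) by auto
  have cyc': "weight ?f v xs \<le> 0" if "elementary_cycle (arc A) v xs" for v xs
    using cyc[OF that] by (simp add: weight_diff_const)
  have gap': "weight ?f v xs \<le> - \<delta> * real (length xs)"
    if "elementary_cycle (arc A) v xs" "weight ?f v xs < 0" for v xs
    using gap[OF that(1)] that(2) by (simp add: weight_diff_const algebra_simps)
  have crit': "weight ?f c zs = 0"
    using crit(2) by (simp add: weight_diff_const)
  have entries': "m - \<rho> \<le> ?f i j" "?f i j \<le> M - \<rho>" if "arc A i j" for i j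
    using entries[OF that] by simp_all
  show "periodic_from (maxplus_power A) (fact CARD('n)) \<rho> K"
  proof (rule periodic_from_maxplus_power[OF A(1)])
    fix k k' i j xs
    assume k: "K \<le> k" "K \<le> k'" "k mod fact CARD('n) = k' mod fact CARD('n)"
      and xs: "walk (arc A) i xs j" "length xs = k"
    have "(real K - real CARD('n) + 1) * \<delta> \<le> (real k - real CARD('n) + 1) * \<delta>"
      using k(1) \<open>0 \<le> \<delta>\<close> by (intro mult_right_mono) auto
    with K(1) have gain: "2 * real CARD('n) ^ 2 * ((M - \<rho>) - (m - \<rho>)) \<le> (real k - real CARD('n) + 1) * \<delta>"
      by simp
    have "2 * CARD('n)\<^sup>2 \<le> k' + 2"
      using K(2) k(2) by linarith
    from walk_transfer[where E = "arc A" and f = ?f and m = "m - \<rho>" and M = "M - \<rho>",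
        OF irreducible_matrix_walk[OF A(2)] cyc' gap' crit(1) crit' entries'(1) \<open>m - \<rho> \<le> 0\<close>
          entries'(2) \<open>0 \<le> M - \<rho>\<close> \<open>0 \<le> \<delta>\<close> gain this k(3) xs]
    have "\<exists>ys. walk (arc A) i ys j \<and> length ys = k' \<and> weight ?f i xs \<le> weight ?f i ys" .
    then show "\<exists>ys. walk (arc A) i ys j \<and> length ys = k' \<and>
        weight (entry A) i xs - \<rho> * real k \<le> weight (entry A) i ys - \<rho> * real k'"
      using xs(2) by (auto simp: weight_diff_const)
  qed
qed simp

text \<open>By irreducibility any arc would close up to a closed walk, so there are no arcs and all
  powers from exponent \<open>1\<close> on are \<open>- \<infinity>\<close> everywhere.\<close>

lemma transient_le_1_if_no_cycles:
  fixes A :: "ereal ^ 'n ^ 'n"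
  assumes "maxplus_matrix A" "irreducible_matrix A"
    and "\<nexists>v xs. elementary_cycle (arc A) v xs"
  shows "transient (maxplus_power A) \<le> enat 1"
proof (rule transient_le)
  have no_arc: "\<not> arc A i j" for i j
  proof
    assume "arc A i j"
    moreover obtain xs where "walk (arc A) j xs i"
      using irreducible_matrix_walk[OF assms(2)] by blast
    ultimately have "walk (arc A) i (j # xs) i" by simp
    from closed_walk_contains_cycle[OF this] assms(3) show False by simp
  qed
  show "periodic_from (maxplus_power A) 1 0 1"
  proof (rule periodic_from_maxplus_power[OF assms(1)])
    fix k k' :: nat and i j xs
    assume "1 \<le> k" "walk (arc A) i xs j" "length xs = k"
    then have False
      using no_arc by (cases xs) simp_all
    then show "\<exists>ys. walk (arc A) i ys j \<and> length ys = k' \<and>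
        weight (entry A) i xs - 0 * real k \<le> weight (entry A) i ys - 0 * real k'"
      by (rule FalseE)
  qed
qed simp

lemma finite_entries_arc:
  assumes "maxplus_matrix A" "arc A i j"
  shows "ereal (entry A i j) \<in> finite_entries A"
proof -
  have "ereal (entry A i j) = A $ i $ j \<and> \<bar>A $ i $ j\<bar> \<noteq> \<infinity>"
    using assms by (cases "A $ i $ j") (simp_all add: maxplus_matrix_def)
  then show ?thesis
    unfolding finite_entries_def mem_Collect_eq by (intro exI)
qed

lemma finite_finite_entries: "finite (finite_entries A)"
proof -
  have "finite_entries A \<subseteq> (\<lambda>(i, j). A $ i $ j) ` UNIV"
    by (auto simp: finite_entries_def)
  then show ?thesis by (rule finite_subset) simp
qed

theorem theorem7:
  fixes A :: "ereal ^ 'n ^ 'n"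
  assumes "maxplus_matrix A" and "irreducible_matrix A"
  shows "ereal_of_enat (transient (maxplus_power A))
    \<le> 2 * ereal (real CARD('n)) ^ 2
      + 2 * ereal (real CARD('n)) ^ 2 * maxplus_spread A
        / (max_cycle_mean A - second_cycle_mean A)"
proof -
  let ?n = "real CARD('n)" and ?mean = "\<lambda>v xs. weight (entry A) v xs / real (length xs)"
  have n: "?n \<ge> 1"
    by (simp add: Suc_le_eq)
  have n2: "?n ^ 2 \<ge> ?n"
    using n by (simp add: power2_eq_square)
  have sq: "2 * ereal ?n ^ 2 = ereal (2 * ?n ^ 2)"
    by (simp add: power2_eq_square)
  show ?thesis
  proof (cases "\<exists>v xs. elementary_cycle (arc A) v xs")
    case False
    then have "cycle_means A = {}"
      unfolding cycle_means_eq[OF assms(1)] by auto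
    \<comment> \<open>Both means are \<open>- \<infinity>\<close>, and in \<open>ereal\<close> their
      difference is \<open>\<infinity>\<close>. Division by it gives \<open>0\<close>, whatever
      value the maximum and minimum over no finite entries have.\<close>
    then have "max_cycle_mean A - second_cycle_mean A = \<infinity>"
      by (simp add: max_cycle_mean_def second_cycle_mean_def bot_ereal_def)
    moreover have "ereal_of_enat (transient (maxplus_power A)) \<le> ereal (2 * ?n ^ 2)"
    proof -
      have "ereal_of_enat (transient (maxplus_power A)) \<le> ereal_of_enat (enat 1)"
        using transient_le_1_if_no_cycles[OF assms False] by (simp only: ereal_of_enat_le_iff)
      also have "\<dots> \<le> ereal (2 * ?n ^ 2)"
        using n n2 by (simp only: ereal_of_enat_simps ereal_less_eq of_nat_1)
      finally show ?thesis .
    qed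
    ultimately show ?thesis
      unfolding sq by (simp add: divide_ereal_def)
  next
    case True
    let ?S = "cycle_means A"
    have fin: "finite ?S" and ne: "?S \<noteq> {}"
      using finite_cycle_means[OF assms(1)] True cycle_means_eq[OF assms(1)] by auto
    have max: "max_cycle_mean A = Max ?S"
      unfolding max_cycle_mean_def using fin ne by (rule Max_Sup[symmetric])
    have "Max ?S \<in> ?S"
      using fin ne by (rule Max_in)
    then obtain c zs where c: "elementary_cycle (arc A) c zs" "Max ?S = ereal (?mean c zs)"
      unfolding cycle_means_eq[OF assms(1)] by auto
    define \<rho> where "\<rho> = ?mean c zs"
    have len: "real (length xs) > 0" if "elementary_cycle (arc A) v xs" for v xs
      using that by (simp add: elementary_cycle_def)
    have crit: "weight (entry A) c zs = \<rho> * real (length zs)"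
      using len[OF c(1)] by (simp add: \<rho>_def)
    have mean_in: "ereal (?mean v xs) \<in> ?S" if "elementary_cycle (arc A) v xs" for v xs
      using that unfolding cycle_means_eq[OF assms(1)] by force
    have mean_le: "?mean v xs \<le> \<rho>" if "elementary_cycle (arc A) v xs" for v xs
      using Max_ge[OF fin mean_in[OF that]] c(2) by (simp add: \<rho>_def)
    have cyc: "weight (entry A) v xs \<le> \<rho> * real (length xs)"
      if "elementary_cycle (arc A) v xs" for v xs
      using mean_le[OF that] len[OF that] by (simp add: pos_divide_le_eq)
    \<comment> \<open>An arc of the critical cycle shows that there are finite entries.\<close>
    obtain u w us where cw: "c = u" "zs = w # us" "arc A u w"
      using c(1) by (cases zs) (auto simp: elementary_cycle_def)
    have fe: "finite (finite_entries A)" "finite_entries A \<noteq> {}"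
      using finite_finite_entries finite_entries_arc[OF assms(1) cw(3)] by auto
    obtain M where M: "Max (finite_entries A) = ereal M"
      using Max_in[OF fe] by (auto simp: finite_entries_def)
    obtain m where m: "Min (finite_entries A) = ereal m"
      using Min_in[OF fe] by (auto simp: finite_entries_def)
    have entries: "m \<le> entry A i j" "entry A i j \<le> M" if "arc A i j" for i j
      using Min_le[OF fe(1) finite_entries_arc[OF assms(1) that]]
        Max_ge[OF fe(1) finite_entries_arc[OF assms(1) that]] m M by auto
    have spread: "maxplus_spread A = ereal (M - m)" "m \<le> M"
      using entries[OF cw(3)] by (auto simp: maxplus_spread_def m M)
    let ?S2 = "{x \<in> ?S. x < max_cycle_mean A}"
    have noncritical: "ereal (?mean v xs) \<in> ?S2"
      if "elementary_cycle (arc A) v xs" "weight (entry A) v xs < \<rho> * real (length xs)" for v xs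
      using that mean_in[OF that(1)] len[OF that(1)] max c(2)
      by (simp add: \<rho>_def[symmetric] pos_divide_less_eq)
    show ?thesis
    proof (cases "?S2 = {}")
      case True
      \<comment> \<open>The second mean is \<open>Sup {} = - \<infinity>\<close>; the infinite
        denominator makes the quotient \<open>0\<close>.\<close>
      then have "max_cycle_mean A - second_cycle_mean A = \<infinity>"
        unfolding second_cycle_mean_def True using max c(2) by (simp add: bot_ereal_def)
      moreover have "transient (maxplus_power A) \<le> enat (2 * CARD('n)\<^sup>2)"
      \<comment> \<open>Every cycle is critical, so the gap condition is vacuous for any
        \<open>\<delta>\<close>. This choice satisfies the length condition because its other factor
        is at least \<open>1\<close>.\<close>
      proof (rule transient_le_of_gap[OF assms cyc _ c(1) crit entries,
            where \<delta> = "2 * ?n ^ 2 * (M - m)"])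
        fix v xs
        assume vx: "elementary_cycle (arc A) v xs" "weight (entry A) v xs < \<rho> * real (length xs)"
        then have "ereal (?mean v xs) \<in> ?S2"
          by (rule noncritical)
        with True show "weight (entry A) v xs \<le> (\<rho> - 2 * ?n ^ 2 * (M - m)) * real (length xs)"
          by blast
      next
        show "2 * ?n ^ 2 * (M - m) \<le> (real (2 * CARD('n)\<^sup>2) - ?n + 1) * (2 * ?n ^ 2 * (M - m))"
        proof -
          have "real (2 * CARD('n)\<^sup>2) = 2 * ?n ^ 2"
            by simp
          then have "1 \<le> real (2 * CARD('n)\<^sup>2) - ?n + 1"
            using n n2 by linarith
          from mult_right_mono[OF this, of "2 * ?n ^ 2 * (M - m)"] show ?thesis
            using spread(2) by simp
        qed
      qed (use spread(2) in auto)
      then have "ereal_of_enat (transient (maxplus_power A)) \<le> ereal_of_enat (enat (2 * CARD('n)\<^sup>2))"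
        by (simp only: ereal_of_enat_le_iff)
      moreover have "\<dots> = ereal (2 * ?n ^ 2)"
        by simp
      ultimately show ?thesis
        unfolding sq by (simp add: divide_ereal_def)
    next
      case False
      have fin2: "finite ?S2"
        using fin by simp
      have second: "second_cycle_mean A = Max ?S2"
        unfolding second_cycle_mean_def using fin2 False by (rule Max_Sup[symmetric])
      have "Max ?S2 \<in> ?S2"
        using fin2 False by (rule Max_in)
      then obtain l where l: "Max ?S2 = ereal l" "l < \<rho>"
        unfolding cycle_means_eq[OF assms(1)] using max c(2) by (auto simp: \<rho>_def)
      define \<delta> where "\<delta> = \<rho> - l"
      have \<delta>: "\<delta> > 0"
        using l(2) by (simp add: \<delta>_def)
      define R where "R = 2 * ?n ^ 2 + 2 * ?n ^ 2 * (M - m) / \<delta>"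
      \<comment> \<open>The bound \<open>R\<close> need not be an integer, whereas the transient
        must be bounded by a natural number not above \<open>R\<close>.\<close>
      define K where "K = nat \<lfloor>R\<rfloor>"
      have "R \<ge> 2 * ?n ^ 2"
        using spread(2) \<delta> by (simp add: R_def)
      then have "real (2 * CARD('n)\<^sup>2) \<le> R"
        by simp
      then have K1: "2 * CARD('n)\<^sup>2 \<le> K"
        unfolding K_def by (rule le_nat_floor)
      have "R \<ge> 0"
        using \<open>R \<ge> 2 * ?n ^ 2\<close> n n2 by linarith
      then have K2: "real K \<le> R" "R < real K + 1"
        unfolding K_def by linarith+
      have "2 * ?n ^ 2 * (M - m) = (R - 2 * ?n ^ 2) * \<delta>"
        using \<delta> by (simp add: R_def)
      also have "\<dots> \<le> (real K - ?n + 1) * \<delta>"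
      proof (rule mult_right_mono)
        \<comment> \<open>Rounding down loses less than \<open>1\<close>; the slack between
          \<open>?n\<close> and \<open>2 * ?n ^ 2\<close> covers it.\<close>
        show "R - 2 * ?n ^ 2 \<le> real K - ?n + 1"
          using K2 n n2 by linarith
      qed (use \<delta> in simp)
      finally have K3: "2 * ?n ^ 2 * (M - m) \<le> (real K - ?n + 1) * \<delta>" .
      have "transient (maxplus_power A) \<le> enat K"
      proof (rule transient_le_of_gap[OF assms cyc _ c(1) crit entries _ K3 K1])
        fix v xs
        assume vx: "elementary_cycle (arc A) v xs" "weight (entry A) v xs < \<rho> * real (length xs)"
        then have "ereal (?mean v xs) \<in> ?S2"
          by (rule noncritical)
        from Max_ge[OF fin2 this] show "weight (entry A) v xs \<le> (\<rho> - \<delta>) * real (length xs)"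
          using len[OF vx(1)] l(1) by (simp add: \<delta>_def pos_divide_le_eq)
      qed (use \<delta> in auto)
      then have "ereal_of_enat (transient (maxplus_power A)) \<le> ereal_of_enat (enat K)"
        by (simp only: ereal_of_enat_le_iff)
      also have "\<dots> \<le> ereal R"
        using K2(1) by simp
      also have "ereal R = ereal (2 * ?n ^ 2) + ereal (2 * ?n ^ 2) * maxplus_spread A
          / (max_cycle_mean A - second_cycle_mean A)"
        using \<delta> max c(2) second l(1) by (simp add: R_def spread(1) \<delta>_def \<rho>_def)
      finally show ?thesis
        unfolding sq .
    qed
  qed
qed

end
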